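(* (Working in $\mathsf{ZF}$.) Suppose that $\lambda$ is a singular cardinal with $\operatorname{cf}(\lambda)=\kappa$. If there is a uniform ultrafilter on $\lambda$, then there is a uniform ultrafilter on $\kappa$.
   Context: No form of the axiom of choice is assumed. An ultrafilter $\mathcal F$ on a set $X$ is uniform if every $A\in\mathcal F$ has the same cardinality as $X$. *)

theory Defs
  imports Main
begin

text \<open>
  Isabelle/HOL has choice built in, so a statement of ZF cannot be rendered by one about HOL sets.
  It is rendered as truth in every first-order model of ZF, which by Goedel's completeness theorem
  is the same as provability in ZF.  A structure for the language of set theory is a type \<open>'a\<close>
  with a binary relation \<open>\<epsilon>\<close> (not assumed well-founded, and not
  assumed to satisfy choice).  Separation and Replacement are the first-order schemas, so they range
  over formulas with parameters and not over arbitrary HOL predicates.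

  All set-theoretic notions below quantify over elements of \<open>'a\<close> only; each is the
  interpretation in \<open>('a, \<epsilon>)\<close> of a first-order formula in the single
  symbol \<open>\<epsilon>\<close>.
\<close>

datatype fm = Mem nat nat | Equal nat nat | Neg fm | Conj fm fm | All nat fm

primrec sat :: "('a \<Rightarrow> 'a \<Rightarrow> bool) \<Rightarrow> fm \<Rightarrow> (nat \<Rightarrow> 'a) \<Rightarrow> bool" where
  "sat E (Mem i j) e \<longleftrightarrow> E (e i) (e j)"
| "sat E (Equal i j) e \<longleftrightarrow> e i = e j"
| "sat E (Neg p) e \<longleftrightarrow> \<not> sat E p e"
| "sat E (Conj p q) e \<longleftrightarrow> sat E p e \<and> sat E q e"
| "sat E (All i p) e \<longleftrightarrow> (\<forall>x. sat E p (e(i := x)))"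

locale set_structure =
  fixes mem :: "'a \<Rightarrow> 'a \<Rightarrow> bool" (infix \<open>\<epsilon>\<close> 50)
begin

definition is_subset :: "'a \<Rightarrow> 'a \<Rightarrow> bool" where
  "is_subset a b \<longleftrightarrow> (\<forall>x. x \<epsilon> a \<longrightarrow> x \<epsilon> b)"

definition is_empty :: "'a \<Rightarrow> bool" where
  "is_empty a \<longleftrightarrow> (\<forall>x. \<not> x \<epsilon> a)"

definition is_succ :: "'a \<Rightarrow> 'a \<Rightarrow> bool" where
  "is_succ s a \<longleftrightarrow> (\<forall>x. x \<epsilon> s \<longleftrightarrow> x \<epsilon> a \<or> x = a)"

definition is_upair :: "'a \<Rightarrow> 'a \<Rightarrow> 'a \<Rightarrow> bool" where
  "is_upair p a b \<longleftrightarrow> (\<forall>x. x \<epsilon> p \<longleftrightarrow> x = a \<or> x = b)"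

text \<open>Kuratowski pairs.\<close>

definition is_pair :: "'a \<Rightarrow> 'a \<Rightarrow> 'a \<Rightarrow> bool" where
  "is_pair p a b \<longleftrightarrow> (\<exists>u v. is_upair u a a \<and> is_upair v a b \<and> is_upair p u v)"

definition maps_to :: "'a \<Rightarrow> 'a \<Rightarrow> 'a \<Rightarrow> bool" where
  "maps_to f x y \<longleftrightarrow> (\<exists>p. p \<epsilon> f \<and> is_pair p x y)"

definition is_function :: "'a \<Rightarrow> 'a \<Rightarrow> 'a \<Rightarrow> bool" where
  "is_function f a b \<longleftrightarrow>
     (\<forall>p. p \<epsilon> f \<longrightarrow> (\<exists>x y. x \<epsilon> a \<and> y \<epsilon> b \<and> is_pair p x y)) \<and>
     (\<forall>x. x \<epsilon> a \<longrightarrow> (\<exists>!y. maps_to f x y))"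

definition is_bijection :: "'a \<Rightarrow> 'a \<Rightarrow> 'a \<Rightarrow> bool" where
  "is_bijection f a b \<longleftrightarrow>
     is_function f a b \<and>
     (\<forall>x x' y. maps_to f x y \<and> maps_to f x' y \<longrightarrow> x = x') \<and>
     (\<forall>y. y \<epsilon> b \<longrightarrow> (\<exists>x. maps_to f x y))"

definition equipotent :: "'a \<Rightarrow> 'a \<Rightarrow> bool" where
  "equipotent a b \<longleftrightarrow> (\<exists>f. is_bijection f a b)"

definition is_transitive :: "'a \<Rightarrow> bool" where
  "is_transitive a \<longleftrightarrow> (\<forall>x. x \<epsilon> a \<longrightarrow> is_subset x a)"

definition wellordered_by_mem :: "'a \<Rightarrow> bool" where
  "wellordered_by_mem a \<longleftrightarrow>
     (\<forall>x. x \<epsilon> a \<longrightarrow> \<not> x \<epsilon> x) \<and>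
     (\<forall>x y z. x \<epsilon> a \<and> y \<epsilon> a \<and> z \<epsilon> a \<and> x \<epsilon> y \<and> y \<epsilon> z \<longrightarrow> x \<epsilon> z) \<and>
     (\<forall>x y. x \<epsilon> a \<and> y \<epsilon> a \<longrightarrow> x \<epsilon> y \<or> x = y \<or> y \<epsilon> x) \<and>
     (\<forall>b. is_subset b a \<and> \<not> is_empty b \<longrightarrow> (\<exists>x. x \<epsilon> b \<and> (\<forall>y. y \<epsilon> b \<longrightarrow> x = y \<or> x \<epsilon> y)))"

definition is_ordinal :: "'a \<Rightarrow> bool" where
  "is_ordinal a \<longleftrightarrow> is_transitive a \<and> wellordered_by_mem a"

text \<open>Von Neumann natural numbers of the structure, possibly nonstandard.\<close>

definition is_natural :: "'a \<Rightarrow> bool" where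
  "is_natural n \<longleftrightarrow>
     is_ordinal n \<and>
     (\<forall>m. m = n \<or> m \<epsilon> n \<longrightarrow> is_empty m \<or> (\<exists>k. is_succ m k))"

definition is_cardinal :: "'a \<Rightarrow> bool" where
  "is_cardinal a \<longleftrightarrow> is_ordinal a \<and> (\<forall>b. b \<epsilon> a \<longrightarrow> \<not> equipotent b a)"

definition is_cofinal_map :: "'a \<Rightarrow> 'a \<Rightarrow> 'a \<Rightarrow> bool" where
  "is_cofinal_map f a l \<longleftrightarrow>
     is_function f a l \<and>
     (\<forall>b. b \<epsilon> l \<longrightarrow> (\<exists>x y. x \<epsilon> a \<and> maps_to f x y \<and> (b = y \<or> b \<epsilon> y)))"

definition is_cofinality :: "'a \<Rightarrow> 'a \<Rightarrow> bool" where
  "is_cofinality k l \<longleftrightarrow>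
     is_ordinal k \<and> (\<exists>f. is_cofinal_map f k l) \<and>
     (\<forall>a. a \<epsilon> k \<longrightarrow> \<not> (\<exists>f. is_cofinal_map f a l))"

definition is_singular_cardinal :: "'a \<Rightarrow> bool" where
  "is_singular_cardinal l \<longleftrightarrow>
     is_cardinal l \<and> \<not> is_natural l \<and> (\<exists>k. is_cofinality k l \<and> k \<epsilon> l)"

definition is_ultrafilter_on :: "'a \<Rightarrow> 'a \<Rightarrow> bool" where
  "is_ultrafilter_on F X \<longleftrightarrow>
     (\<forall>A. A \<epsilon> F \<longrightarrow> is_subset A X) \<and>
     X \<epsilon> F \<and>
     (\<forall>A. A \<epsilon> F \<longrightarrow> \<not> is_empty A) \<and>
     (\<forall>A B. A \<epsilon> F \<and> is_subset A B \<and> is_subset B X \<longrightarrow> B \<epsilon> F) \<and>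
     (\<forall>A B. A \<epsilon> F \<and> B \<epsilon> F \<longrightarrow> (\<exists>C. C \<epsilon> F \<and> (\<forall>x. x \<epsilon> C \<longleftrightarrow> x \<epsilon> A \<and> x \<epsilon> B))) \<and>
     (\<forall>A. is_subset A X \<longrightarrow> A \<epsilon> F \<or> (\<exists>C. C \<epsilon> F \<and> (\<forall>x. x \<epsilon> C \<longleftrightarrow> x \<epsilon> X \<and> \<not> x \<epsilon> A)))"

definition is_uniform_ultrafilter_on :: "'a \<Rightarrow> 'a \<Rightarrow> bool" where
  "is_uniform_ultrafilter_on F X \<longleftrightarrow>
     is_ultrafilter_on F X \<and> (\<forall>A. A \<epsilon> F \<longrightarrow> equipotent A X)"

end

text \<open>
  In the two schemas the environment \<open>e\<close> supplies the parameters of the formula \<open>p\<close>.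
\<close>

locale ZF_model = set_structure +
  assumes extensionality: "(\<forall>x. x \<epsilon> a \<longleftrightarrow> x \<epsilon> b) \<Longrightarrow> a = b"
    and foundation: "\<not> is_empty a \<Longrightarrow> \<exists>x. x \<epsilon> a \<and> (\<forall>y. y \<epsilon> x \<longrightarrow> \<not> y \<epsilon> a)"
    and pairing: "\<exists>p. is_upair p a b"
    and union: "\<exists>u. \<forall>x. x \<epsilon> u \<longleftrightarrow> (\<exists>y. x \<epsilon> y \<and> y \<epsilon> a)"
    and powerset: "\<exists>P. \<forall>x. x \<epsilon> P \<longleftrightarrow> is_subset x a"
    and infinity: "\<exists>w. (\<exists>z. z \<epsilon> w \<and> is_empty z) \<and> (\<forall>x. x \<epsilon> w \<longrightarrow> (\<exists>s. s \<epsilon> w \<and> is_succ s x))"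
    and separation: "\<exists>b. \<forall>x. x \<epsilon> b \<longleftrightarrow> x \<epsilon> a \<and> sat (\<epsilon>) p (e(0 := x))"
    and replacement:
      "(\<forall>x y z. x \<epsilon> a \<and> sat (\<epsilon>) p (e(0 := x, 1 := y)) \<and> sat (\<epsilon>) p (e(0 := x, 1 := z)) \<longrightarrow> y = z) \<Longrightarrow>
       \<exists>b. \<forall>y. y \<epsilon> b \<longleftrightarrow> (\<exists>x. x \<epsilon> a \<and> sat (\<epsilon>) p (e(0 := x, 1 := y)))"

end

theory Submission
  imports Defs
begin

text \<open>
  Let \<open>f\<close> be a cofinal map from \<open>\<kappa>\<close> to \<open>\<lambda>\<close> and send \<open>\<alpha> \<in> \<lambda>\<close> to the least \<open>i \<in> \<kappa>\<close> with
  \<open>\<alpha> \<le> f i\<close>.  The image of the given ultrafilter under this map is an ultrafilter on \<open>\<kappa>\<close>.  If \<open>A\<close>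
  belongs to it, the preimage of \<open>A\<close> is equipotent to the cardinal \<open>\<lambda>\<close> and hence unbounded
  in \<open>\<lambda>\<close>, so \<open>f\<close> restricted to \<open>A\<close> is still cofinal; by minimality of \<open>\<kappa>\<close> the order type of \<open>A\<close>
  is \<open>\<kappa>\<close>.
\<close>

section \<open>Definability with parameters\<close>

primrec free_vars :: "fm \<Rightarrow> nat set" where
  "free_vars (Mem i j) = {i, j}"
| "free_vars (Equal i j) = {i, j}"
| "free_vars (Neg p) = free_vars p"
| "free_vars (Conj p q) = free_vars p \<union> free_vars q"
| "free_vars (All i p) = free_vars p - {i}"

lemma finite_free_vars: "finite (free_vars p)"
  by (induction p) auto

lemma sat_cong_free_vars:
  assumes "\<And>n. n \<in> free_vars p \<Longrightarrow> e n = e' n"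
  shows "sat E p e \<longleftrightarrow> sat E p e'"
  using assms
proof (induction p arbitrary: e e')
  case (Neg p)
  have "sat E p e \<longleftrightarrow> sat E p e'" by (rule Neg.IH) (simp add: Neg.prems)
  then show ?case by simp
next
  case (Conj p q)
  have "sat E p e \<longleftrightarrow> sat E p e'" by (rule Conj.IH(1)) (simp add: Conj.prems)
  moreover have "sat E q e \<longleftrightarrow> sat E q e'" by (rule Conj.IH(2)) (simp add: Conj.prems)
  ultimately show ?case by simp
next
  case (All i p)
  have "sat E p (e(i := x)) \<longleftrightarrow> sat E p (e'(i := x))" for x
    by (rule All.IH) (simp add: All.prems)
  then show ?case by simp
qed simp_all

lemma ex_sat_substitution: "\<exists>q. \<forall>e. sat E q e \<longleftrightarrow> sat E p (\<lambda>n. e (r n))"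
proof (induction p arbitrary: r)
  case (Mem i j)
  show ?case by (rule exI[of _ "Mem (r i) (r j)"]) simp
next
  case (Equal i j)
  show ?case by (rule exI[of _ "Equal (r i) (r j)"]) simp
next
  case (Neg p)
  then show ?case by (metis sat.simps(3))
next
  case (Conj p q)
  then show ?case by (metis sat.simps(4))
next
  case (All i p)
  obtain m where fresh: "m \<notin> r ` free_vars p"
    using ex_new_if_finite[OF infinite_UNIV_nat finite_imageI[OF finite_free_vars]] by blast
  obtain q where q: "\<And>e. sat E q e \<longleftrightarrow> sat E p (\<lambda>n. e ((r(i := m)) n))"
    using All.IH by blast
  have "sat E q (e(m := x)) \<longleftrightarrow> sat E p ((\<lambda>n. e (r n))(i := x))" for e x
    unfolding q by (rule sat_cong_free_vars) (use fresh in auto)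
  then have "\<forall>e. sat E (All m q) e \<longleftrightarrow> sat E (All i p) (\<lambda>n. e (r n))" by simp
  then show ?case ..
qed

inductive var_or_const :: "((nat \<Rightarrow> 'a) \<Rightarrow> 'a) \<Rightarrow> bool" where
  var: "var_or_const (\<lambda>e. e i)"
| const: "var_or_const (\<lambda>e. a)"

lemma var_or_const_substitute:
  assumes "var_or_const t" "\<And>n. var_or_const (s n)"
  shows "var_or_const (\<lambda>e. t (\<lambda>n. s n e))"
  using assms(1) by cases (simp_all add: assms(2) var_or_const.const)

context set_structure
begin

definition definable :: "((nat \<Rightarrow> 'a) \<Rightarrow> bool) \<Rightarrow> bool" where
  "definable P \<longleftrightarrow>
     (\<exists>p s. (\<forall>n. var_or_const (s n)) \<and> (\<forall>e. P e \<longleftrightarrow> sat (\<epsilon>) p (\<lambda>n. s n e)))"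

lemma definable_sat:
  assumes "\<And>n. var_or_const (s n)"
  shows "definable (\<lambda>e. sat (\<epsilon>) p (\<lambda>n. s n e))"
  unfolding definable_def using assms by blast

lemma definableE:
  assumes "definable P"
  obtains p s where "\<And>n. var_or_const (s n)" "P = (\<lambda>e. sat (\<epsilon>) p (\<lambda>n. s n e))"
proof -
  obtain p s where "\<forall>n. var_or_const (s n)" "\<forall>e. P e \<longleftrightarrow> sat (\<epsilon>) p (\<lambda>n. s n e)"
    using assms unfolding definable_def by (elim exE conjE)
  then show thesis by (intro that[of s p] ext) simp_all
qed

lemma definable_substitute:
  assumes "definable P" "\<And>n. var_or_const (s n)"
  shows "definable (\<lambda>e. P (\<lambda>n. s n e))"
  using assms(1)
proof (rule definableE)
  fix p t assume t: "\<And>n. var_or_const (t n)" and P: "P = (\<lambda>e. sat (\<epsilon>) p (\<lambda>n. t n e))"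
  show ?thesis
    unfolding P using definable_sat[OF var_or_const_substitute[OF t assms(2)]] .
qed

lemma definable_mem:
  assumes "var_or_const s" "var_or_const t"
  shows "definable (\<lambda>e. s e \<epsilon> t e)"
  using definable_sat[of "\<lambda>n. if n = 0 then s else t" "Mem 0 1"] assms by simp

lemma definable_eq:
  assumes "var_or_const s" "var_or_const t"
  shows "definable (\<lambda>e. s e = t e)"
  using definable_sat[of "\<lambda>n. if n = 0 then s else t" "Equal 0 1"] assms by simp

lemma definable_not:
  assumes "definable P"
  shows "definable (\<lambda>e. \<not> P e)"
  using assms
proof (rule definableE)
  fix p s assume s: "\<And>n. var_or_const (s n)" and P: "P = (\<lambda>e. sat (\<epsilon>) p (\<lambda>n. s n e))"
  show ?thesis using definable_sat[OF s, of "Neg p"] unfolding P by simp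
qed

lemma definable_conj:
  assumes "definable P" "definable Q"
  shows "definable (\<lambda>e. P e \<and> Q e)"
proof -
  obtain p s where s: "\<And>n. var_or_const (s n)" and P: "P = (\<lambda>e. sat (\<epsilon>) p (\<lambda>n. s n e))"
    by (rule definableE[OF assms(1)]) blast
  obtain q t where t: "\<And>n. var_or_const (t n)" and Q: "Q = (\<lambda>e. sat (\<epsilon>) q (\<lambda>n. t n e))"
    by (rule definableE[OF assms(2)]) blast
  define st where "st n = (if even n then s (n div 2) else t (n div 2))" for n
  obtain p' where p': "\<And>e. sat (\<epsilon>) p' e \<longleftrightarrow> sat (\<epsilon>) p (\<lambda>n. e (2 * n))"
    using ex_sat_substitution[of _ p "\<lambda>n. 2 * n"] by blast
  obtain q' where q': "\<And>e. sat (\<epsilon>) q' e \<longleftrightarrow> sat (\<epsilon>) q (\<lambda>n. e (Suc (2 * n)))"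
    using ex_sat_substitution[of _ q "\<lambda>n. Suc (2 * n)"] by blast
  have "var_or_const (st n)" for n
    unfolding st_def using s t by simp
  then have "definable (\<lambda>e. sat (\<epsilon>) (Conj p' q') (\<lambda>n. st n e))"
    by (rule definable_sat)
  then show ?thesis by (simp add: P Q p' q' st_def)
qed

text \<open>
  Several variables of the formula may stand for variable \<open>0\<close> of the environment; substitution
  identifies them, so that a single quantifier binds them all.
\<close>

lemma definable_binderE:
  assumes "definable (\<lambda>e. Q (e 0) (\<lambda>n. e (Suc n)))"
  obtains p t where "\<And>n. var_or_const (t n)"
    and "\<And>x e. Q x e \<longleftrightarrow> sat (\<epsilon>) p ((\<lambda>n. t n e)(0 := x))"
proof -
  obtain p s where s: "\<And>n. var_or_const (s n)"
    and p: "(\<lambda>e. Q (e 0) (\<lambda>n. e (Suc n))) = (\<lambda>e. sat (\<epsilon>) p (\<lambda>n. s n e))"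
    by (rule definableE[OF assms]) blast
  define r where "r n = (if s n = (\<lambda>e. e 0) then 0 else Suc n)" for n
  obtain q where q: "\<And>e. sat (\<epsilon>) q e \<longleftrightarrow> sat (\<epsilon>) p (\<lambda>n. e (r n))"
    using ex_sat_substitution[of _ p r] by blast
  define t where "t n e = s (n - 1) (case_nat undefined e)" for n e
  show thesis
  proof
    have "var_or_const (\<lambda>e. case_nat undefined e m)" for m
      by (cases m) (simp_all add: var_or_const.intros)
    then show "var_or_const (t n)" for n
      unfolding t_def by (rule var_or_const_substitute[OF s])
    have "((\<lambda>n. t n e)(0 := x)) (r n) = s n (case_nat x e)" for e x n
    proof (cases "s n = (\<lambda>e. e 0)")
      case True
      then show ?thesis by (simp add: r_def)
    next
      case False
      with s[of n] show ?thesis by cases (auto simp: r_def t_def split: nat.split)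
    qed
    then show "Q x e \<longleftrightarrow> sat (\<epsilon>) q ((\<lambda>n. t n e)(0 := x))" for x e
      unfolding q using fun_cong[OF p, of "case_nat x e"] by simp
  qed
qed

lemma definable_all:
  assumes "definable (\<lambda>e. Q (e 0) (\<lambda>n. e (Suc n)))"
  shows "definable (\<lambda>e. \<forall>x. Q x e)"
  using assms
proof (rule definable_binderE)
  fix p t assume t: "\<And>n. var_or_const (t n)"
    and Q: "\<And>x e. Q x e \<longleftrightarrow> sat (\<epsilon>) p ((\<lambda>n. t n e)(0 := x))"
  show ?thesis using definable_sat[OF t, of "All 0 p"] by (simp add: Q)
qed

lemma definable_imp:
  assumes "definable P" "definable Q"
  shows "definable (\<lambda>e. P e \<longrightarrow> Q e)"
  using definable_not[OF definable_conj[OF assms(1) definable_not[OF assms(2)]]] by simp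

lemma definable_disj:
  assumes "definable P" "definable Q"
  shows "definable (\<lambda>e. P e \<or> Q e)"
  using definable_imp[OF definable_not[OF assms(1)] assms(2)]
  by (simp add: disj_imp)

lemma definable_iff:
  assumes "definable P" "definable Q"
  shows "definable (\<lambda>e. P e \<longleftrightarrow> Q e)"
  using definable_conj[OF definable_imp[OF assms] definable_imp[OF assms(2,1)]]
  by (simp add: iff_conv_conj_imp)

lemma definable_ex:
  assumes "definable (\<lambda>e. Q (e 0) (\<lambda>n. e (Suc n)))"
  shows "definable (\<lambda>e. \<exists>x. Q x e)"
  using definable_not[OF definable_all, of "\<lambda>x e. \<not> Q x e"] definable_not[OF assms] by simp

lemmas definable_connectives =
  definable_all definable_ex definable_imp definable_iff definable_conj definable_disj
  definable_not definable_mem definable_eq var_or_const.intros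

lemma definable_maps_to:
  assumes "var_or_const f" "var_or_const x" "var_or_const y"
  shows "definable (\<lambda>e. maps_to (f e) (x e) (y e))"
proof -
  have "definable (\<lambda>e. maps_to (e 0) (e 1) (e 2))"
    unfolding maps_to_def is_pair_def is_upair_def by (intro definable_connectives)
  from definable_substitute[OF this, of "\<lambda>n. if n = 0 then f else if n = 1 then x else y"]
  show ?thesis using assms by simp
qed

definition definable_pred :: "('a \<Rightarrow> bool) \<Rightarrow> bool" where
  "definable_pred P \<longleftrightarrow> definable (\<lambda>e. P (e 0))"

definition definable_rel :: "('a \<Rightarrow> 'a \<Rightarrow> bool) \<Rightarrow> bool" where
  "definable_rel R \<longleftrightarrow> definable (\<lambda>e. R (e 0) (e 1))"

lemma definable_predI:
  assumes "definable (\<lambda>e. P (e 0))"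
  shows "definable_pred P"
  using assms unfolding definable_pred_def .

lemma definable_relI:
  assumes "definable (\<lambda>e. R (e 0) (e 1))"
  shows "definable_rel R"
  using assms unfolding definable_rel_def .

lemma definable_predD:
  assumes "definable_pred P" "var_or_const t"
  shows "definable (\<lambda>e. P (t e))"
  using definable_substitute[of "\<lambda>e. P (e 0)" "\<lambda>_. t"] assms
  unfolding definable_pred_def by simp

lemma definable_relD:
  assumes "definable_rel R" "var_or_const s" "var_or_const t"
  shows "definable (\<lambda>e. R (s e) (t e))"
  using definable_substitute[of "\<lambda>e. R (e 0) (e 1)" "\<lambda>n. if n = 0 then s else t"] assms
  unfolding definable_rel_def by simp

lemmas definable_intros =
  definable_predI definable_relI definable_connectives definable_maps_to

section \<open>Definable functions\<close>

abbreviation elts :: "'a \<Rightarrow> 'a set" where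
  "elts a \<equiv> {x. x \<epsilon> a}"

abbreviation mem_or_eq :: "'a \<Rightarrow> 'a \<Rightarrow> bool" (infix \<open>\<preceq>\<close> 50) where
  "x \<preceq> y \<equiv> x = y \<or> x \<epsilon> y"

definition graph_on :: "'a \<Rightarrow> ('a \<Rightarrow> 'a) \<Rightarrow> 'a \<Rightarrow> 'a \<Rightarrow> bool" where
  "graph_on a h x y \<longleftrightarrow> x \<epsilon> a \<and> y = h x"

definition definable_fun_on :: "'a \<Rightarrow> ('a \<Rightarrow> 'a) \<Rightarrow> bool" where
  "definable_fun_on a h \<longleftrightarrow> definable_rel (graph_on a h)"

lemma definable_graph_on:
  assumes "definable_fun_on a h" "var_or_const s" "var_or_const t"
  shows "definable (\<lambda>e. graph_on a h (s e) (t e))"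
  using definable_relD[OF assms(1)[unfolded definable_fun_on_def] assms(2,3)] .

lemma definable_fun_on_subset:
  assumes "definable_fun_on a h" "is_subset b a"
  shows "definable_fun_on b h"
proof -
  have "graph_on b h = (\<lambda>x y. x \<epsilon> b \<and> graph_on a h x y)"
    using assms(2) by (auto simp: fun_eq_iff is_subset_def graph_on_def)
  moreover have "definable_rel \<dots>"
    by (intro definable_graph_on[OF assms(1)] definable_intros)
  ultimately show ?thesis by (simp only: definable_fun_on_def)
qed

lemma definable_fun_on_comp:
  assumes "definable_fun_on a h" "h ` elts a \<subseteq> elts b" "definable_fun_on b g"
  shows "definable_fun_on a (g \<circ> h)"
proof -
  have "graph_on a (g \<circ> h) = (\<lambda>x z. \<exists>y. graph_on a h x y \<and> graph_on b g y z)"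
    using assms(2) by (auto simp: fun_eq_iff graph_on_def)
  moreover have "definable_rel \<dots>"
    by (intro definable_graph_on[OF assms(1)] definable_graph_on[OF assms(3)] definable_intros)
  ultimately show ?thesis by (simp only: definable_fun_on_def)
qed

text \<open>The choice operator behind \<open>inv_into\<close> is harmless: only the graph has to be definable.\<close>

lemma definable_fun_on_inv_into:
  assumes "definable_fun_on a h" "bij_betw h (elts a) (elts b)"
  shows "definable_fun_on b (inv_into (elts a) h)"
proof -
  let ?g = "inv_into (elts a) h"
  have "graph_on b ?g y x \<longleftrightarrow> graph_on a h x y" for x y
  proof
    assume "graph_on b ?g y x"
    then have x: "x = ?g y" and y: "y \<in> elts b" unfolding graph_on_def by simp_all
    show "graph_on a h x y"
      using bij_betw_apply[OF bij_betw_inv_into[OF assms(2)] y]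
        bij_betw_inv_into_right[OF assms(2) y]
      unfolding graph_on_def x by simp
  next
    assume "graph_on a h x y"
    then have y: "y = h x" and x: "x \<in> elts a" unfolding graph_on_def by simp_all
    show "graph_on b ?g y x"
      using bij_betw_apply[OF assms(2) x] bij_betw_inv_into_left[OF assms(2) x]
      unfolding graph_on_def y by simp
  qed
  then have "graph_on b ?g = (\<lambda>y x. graph_on a h x y)" by (intro ext)
  moreover have "definable_rel \<dots>"
    by (intro definable_graph_on[OF assms(1)] definable_intros)
  ultimately show ?thesis by (simp only: definable_fun_on_def)
qed

lemma ex_definable_fun_on:
  assumes "definable_rel R" "\<And>x. x \<epsilon> a \<Longrightarrow> \<exists>!y. y \<epsilon> b \<and> R x y"
  shows "\<exists>h. definable_fun_on a h \<and> (\<forall>x. x \<epsilon> a \<longrightarrow> h x \<epsilon> b \<and> R x (h x))"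
proof (intro exI conjI)
  let ?h = "\<lambda>x. THE y. y \<epsilon> b \<and> R x y"
  have h: "?h x \<epsilon> b \<and> R x (?h x)" if "x \<epsilon> a" for x
    using theI'[OF assms(2)[OF that]] .
  then show "\<forall>x. x \<epsilon> a \<longrightarrow> ?h x \<epsilon> b \<and> R x (?h x)" by blast
  have "graph_on a ?h = (\<lambda>x y. x \<epsilon> a \<and> y \<epsilon> b \<and> R x y)"
    unfolding fun_eq_iff graph_on_def using h assms(2) by blast
  moreover have "definable_rel \<dots>"
    by (intro definable_relD[OF assms(1)] definable_intros)
  ultimately show "definable_fun_on a ?h" by (simp only: definable_fun_on_def)
qed

end

section \<open>Sets defined by separation\<close>

context ZF_model
begin

definition sep :: "'a \<Rightarrow> ('a \<Rightarrow> bool) \<Rightarrow> 'a" where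
  "sep a P = (THE b. \<forall>x. x \<epsilon> b \<longleftrightarrow> x \<epsilon> a \<and> P x)"

lemma mem_sep:
  assumes "definable_pred (\<lambda>x. x \<epsilon> a \<and> P x)"
  shows "x \<epsilon> sep a P \<longleftrightarrow> x \<epsilon> a \<and> P x"
proof -
  have "definable (\<lambda>e. e 0 \<epsilon> a \<and> P (e 0))"
    using definable_predD[OF assms var_or_const.var] .
  then obtain p and t :: "nat \<Rightarrow> (nat \<Rightarrow> 'a) \<Rightarrow> 'a"
    where p: "\<And>x e. x \<epsilon> a \<and> P x \<longleftrightarrow> sat (\<epsilon>) p ((\<lambda>n. t n e)(0 := x))"
    by (rule definable_binderE[of "\<lambda>x e. x \<epsilon> a \<and> P x"]) blast
  have "\<exists>b. \<forall>x. x \<epsilon> b \<longleftrightarrow> x \<epsilon> a \<and> sat (\<epsilon>) p ((\<lambda>n. t n (\<lambda>_. a))(0 := x))"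
    by (rule separation)
  then have "\<exists>b. \<forall>x. x \<epsilon> b \<longleftrightarrow> x \<epsilon> a \<and> P x" unfolding p[symmetric] by simp
  then obtain b where b: "\<forall>x. x \<epsilon> b \<longleftrightarrow> x \<epsilon> a \<and> P x" ..
  then have "sep a P = b"
    unfolding sep_def by (intro the_equality extensionality) simp_all
  with b show ?thesis by simp
qed

definition intersection :: "'a \<Rightarrow> 'a \<Rightarrow> 'a" where
  "intersection a b = sep a (\<lambda>x. x \<epsilon> b)"

definition difference :: "'a \<Rightarrow> 'a \<Rightarrow> 'a" where
  "difference a b = sep a (\<lambda>x. \<not> x \<epsilon> b)"

definition preimage :: "('a \<Rightarrow> 'a) \<Rightarrow> 'a \<Rightarrow> 'a \<Rightarrow> 'a" where
  "preimage h a b = sep a (\<lambda>x. h x \<epsilon> b)"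

lemma mem_intersection: "x \<epsilon> intersection a b \<longleftrightarrow> x \<epsilon> a \<and> x \<epsilon> b"
  unfolding intersection_def by (intro mem_sep definable_intros)

lemma mem_difference: "x \<epsilon> difference a b \<longleftrightarrow> x \<epsilon> a \<and> \<not> x \<epsilon> b"
  unfolding difference_def by (intro mem_sep definable_intros)

lemma mem_preimage:
  assumes "definable_fun_on a h"
  shows "x \<epsilon> preimage h a b \<longleftrightarrow> x \<epsilon> a \<and> h x \<epsilon> b"
  unfolding preimage_def
proof (rule mem_sep)
  have "definable_pred (\<lambda>x. \<exists>y. graph_on a h x y \<and> y \<epsilon> b)"
    by (intro definable_graph_on[OF assms] definable_intros)
  then show "definable_pred (\<lambda>x. x \<epsilon> a \<and> h x \<epsilon> b)" by (simp add: graph_on_def)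
qed

lemma preimage_codomain:
  assumes "definable_fun_on a h" "h ` elts a \<subseteq> elts b"
  shows "preimage h a b = a"
  by (rule extensionality) (use assms(2) in \<open>auto simp: mem_preimage[OF assms(1)]\<close>)

lemma preimage_mono:
  assumes "definable_fun_on a h" "is_subset b c"
  shows "is_subset (preimage h a b) (preimage h a c)"
  using assms(2) unfolding is_subset_def mem_preimage[OF assms(1)] by blast

lemma preimage_subset:
  assumes "definable_fun_on a h"
  shows "is_subset (preimage h a b) a"
  unfolding is_subset_def mem_preimage[OF assms] by blast

lemma preimage_intersection:
  assumes "definable_fun_on a h"
  shows "preimage h a (intersection b c) = intersection (preimage h a b) (preimage h a c)"
  by (rule extensionality) (auto simp: mem_preimage[OF assms] mem_intersection)

lemma preimage_difference:
  assumes "definable_fun_on a h" "h ` elts a \<subseteq> elts b"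
  shows "preimage h a (difference b c) = difference a (preimage h a c)"
  by (rule extensionality)
    (use assms(2) in \<open>auto simp: mem_preimage[OF assms(1)] mem_difference\<close>)

section \<open>Functions and equipotence\<close>

lemma ex_pair: "\<exists>p. is_pair p x y"
  unfolding is_pair_def using pairing by blast

lemma pair_inject:
  assumes "is_pair p x y" "is_pair p x' y'"
  shows "x = x' \<and> y = y'"
proof -
  obtain u v where u: "\<And>z. z \<epsilon> u \<longleftrightarrow> z = x" and v: "\<And>z. z \<epsilon> v \<longleftrightarrow> z = x \<or> z = y"
    and p: "\<And>z. z \<epsilon> p \<longleftrightarrow> z = u \<or> z = v"
    using assms(1) unfolding is_pair_def is_upair_def by auto
  obtain u' v' where u': "\<And>z. z \<epsilon> u' \<longleftrightarrow> z = x'" and v': "\<And>z. z \<epsilon> v' \<longleftrightarrow> z = x' \<or> z = y'"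
    and p': "\<And>z. z \<epsilon> p \<longleftrightarrow> z = u' \<or> z = v'"
    using assms(2) unfolding is_pair_def is_upair_def by auto
  have members: "z = u \<or> z = v \<longleftrightarrow> z = u' \<or> z = v'" for z using p p' by blast
  have "u = u' \<or> u = v'" "u' = u \<or> u' = v" using members by blast+
  then have x: "x = x'" using u v u' v' by metis
  have "v = u' \<or> v = v'" "v' = u \<or> v' = v" using members by blast+
  then have "y = y'" using u v u' v' x by metis
  with x show ?thesis ..
qed

lemma ex_cartesian_product: "\<exists>c. \<forall>p. p \<epsilon> c \<longleftrightarrow> (\<exists>x y. x \<epsilon> a \<and> y \<epsilon> b \<and> is_pair p x y)"
proof -
  obtain d where d: "is_upair d a b" using pairing by blast
  obtain u where u: "\<And>x. x \<epsilon> u \<longleftrightarrow> x \<epsilon> a \<or> x \<epsilon> b"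
    using union[of d] d unfolding is_upair_def by metis
  obtain P where P: "\<And>x. x \<epsilon> P \<longleftrightarrow> is_subset x u" using powerset by blast
  obtain PP where PP: "\<And>x. x \<epsilon> PP \<longleftrightarrow> is_subset x P" using powerset by blast
  have in_PP: "p \<epsilon> PP" if "is_pair p x y" "x \<epsilon> a" "y \<epsilon> b" for p x y
    using that unfolding PP P is_pair_def is_upair_def is_subset_def u by metis
  let ?C = "\<lambda>p. \<exists>x y. x \<epsilon> a \<and> y \<epsilon> b \<and> is_pair p x y"
  have "p \<epsilon> sep PP ?C \<longleftrightarrow> p \<epsilon> PP \<and> ?C p" for p
    unfolding is_pair_def is_upair_def by (intro mem_sep definable_intros)
  with in_PP show ?thesis by blast
qed

lemma ex_definable_set_of_pairs:
  assumes "definable_rel R"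
  obtains r where "\<And>p. p \<epsilon> r \<Longrightarrow> \<exists>x y. x \<epsilon> a \<and> y \<epsilon> b \<and> is_pair p x y"
    and "\<And>x y. maps_to r x y \<longleftrightarrow> x \<epsilon> a \<and> y \<epsilon> b \<and> R x y"
proof -
  obtain product where product: "\<And>p. p \<epsilon> product \<longleftrightarrow> (\<exists>x y. x \<epsilon> a \<and> y \<epsilon> b \<and> is_pair p x y)"
    using ex_cartesian_product[of a b] by blast
  let ?r = "sep product (\<lambda>p. \<exists>x y. is_pair p x y \<and> R x y)"
  have mem_r: "p \<epsilon> ?r \<longleftrightarrow> p \<epsilon> product \<and> (\<exists>x y. is_pair p x y \<and> R x y)" for p
    unfolding is_pair_def is_upair_def by (intro mem_sep definable_relD[OF assms] definable_intros)
  show thesis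
  proof
    show "\<exists>x y. x \<epsilon> a \<and> y \<epsilon> b \<and> is_pair p x y" if "p \<epsilon> ?r" for p using that mem_r product by blast
    show "maps_to ?r x y \<longleftrightarrow> x \<epsilon> a \<and> y \<epsilon> b \<and> R x y" for x y
      unfolding maps_to_def mem_r product using ex_pair[of x y] pair_inject by metis
  qed
qed

lemma maps_to_function:
  assumes "is_function f a b"
  shows "\<exists>h. h ` elts a \<subseteq> elts b \<and> maps_to f = graph_on a h"
proof (intro exI conjI)
  have in_ab: "x \<epsilon> a \<and> y \<epsilon> b" if "maps_to f x y" for x y
    using that assms pair_inject unfolding is_function_def maps_to_def by metis
  have ex1: "\<exists>!y. maps_to f x y" if "x \<epsilon> a" for x
    using that assms unfolding is_function_def by blast
  let ?h = "\<lambda>x. THE y. maps_to f x y"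
  have h: "maps_to f x (?h x)" if "x \<epsilon> a" for x using theI'[OF ex1[OF that]] .
  then show "?h ` elts a \<subseteq> elts b" using in_ab by blast
  show "maps_to f = graph_on a ?h"
    unfolding graph_on_def fun_eq_iff using h in_ab ex1 by metis
qed

lemma ex_function_iff:
  "(\<exists>f. is_function f a b \<and> \<Phi> (maps_to f)) \<longleftrightarrow>
    (\<exists>h. definable_fun_on a h \<and> h ` elts a \<subseteq> elts b \<and> \<Phi> (graph_on a h))"
proof (intro iffI; elim exE conjE)
  fix f assume f: "is_function f a b" "\<Phi> (maps_to f)"
  obtain h where "h ` elts a \<subseteq> elts b" and h: "maps_to f = graph_on a h"
    using maps_to_function[OF f(1)] by blast
  moreover have "definable_fun_on a h"
    unfolding definable_fun_on_def h[symmetric] by (intro definable_intros)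
  ultimately show "\<exists>h. definable_fun_on a h \<and> h ` elts a \<subseteq> elts b \<and> \<Phi> (graph_on a h)"
    using f(2) by auto
next
  fix h assume h: "definable_fun_on a h" "h ` elts a \<subseteq> elts b" "\<Phi> (graph_on a h)"
  from h(1)[unfolded definable_fun_on_def] obtain f
    where pairs: "\<And>p. p \<epsilon> f \<Longrightarrow> \<exists>x y. x \<epsilon> a \<and> y \<epsilon> b \<and> is_pair p x y"
      and f: "\<And>x y. maps_to f x y \<longleftrightarrow> x \<epsilon> a \<and> y \<epsilon> b \<and> graph_on a h x y"
    by (rule ex_definable_set_of_pairs[of _ a b]) blast
  have maps_to_f: "maps_to f = graph_on a h"
    unfolding fun_eq_iff f using h(2) by (auto simp: graph_on_def)
  have "is_function f a b"
    unfolding is_function_def maps_to_f graph_on_def using pairs by blast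
  with h(3) show "\<exists>f. is_function f a b \<and> \<Phi> (maps_to f)" unfolding maps_to_f[symmetric] by blast
qed

lemma equipotent_iff:
  "equipotent a b \<longleftrightarrow> (\<exists>h. definable_fun_on a h \<and> bij_betw h (elts a) (elts b))"
proof -
  let ?bij = "\<lambda>m. (\<forall>x x' y. m x y \<and> m x' y \<longrightarrow> x = x') \<and> (\<forall>y. y \<epsilon> b \<longrightarrow> (\<exists>x. m x y))"
  have bij: "bij_betw h (elts a) (elts b) \<longleftrightarrow> h ` elts a \<subseteq> elts b \<and> ?bij (graph_on a h)" for h
    unfolding bij_betw_def inj_on_def graph_on_def by blast
  show ?thesis
    unfolding equipotent_def is_bijection_def bij by (rule ex_function_iff)
qed

lemma equipotent_definable_rel:
  assumes R: "definable_rel R"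
    and unique_value: "\<And>x. x \<epsilon> a \<Longrightarrow> \<exists>!y. y \<epsilon> b \<and> R x y"
    and unique_argument: "\<And>y. y \<epsilon> b \<Longrightarrow> \<exists>!x. x \<epsilon> a \<and> R x y"
  shows "equipotent a b"
proof -
  obtain h where h: "definable_fun_on a h" "\<And>x. x \<epsilon> a \<Longrightarrow> h x \<epsilon> b \<and> R x (h x)"
    using ex_definable_fun_on[OF R unique_value] by blast
  have "inj_on h (elts a)"
  proof (rule inj_onI)
    fix x x' assume x: "x \<in> elts a" and x': "x' \<in> elts a" and eq: "h x = h x'"
    then have "R x (h x')" "R x' (h x')" "h x' \<epsilon> b" using h(2)[of x] h(2)[of x'] by simp_all
    then show "x = x'" using unique_argument[of "h x'"] x x' by blast
  qed
  moreover have "y \<in> h ` elts a" if y: "y \<epsilon> b" for y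
  proof -
    obtain x where x: "x \<epsilon> a" "R x y" using unique_argument[OF y] by blast
    then have "y = h x" using unique_value[OF x(1)] h(2)[OF x(1)] y by blast
    with x(1) show ?thesis by simp
  qed
  then have "h ` elts a = elts b" using h(2) by auto
  ultimately show ?thesis unfolding equipotent_iff bij_betw_def using h(1) by blast
qed

lemma equipotent_sym:
  assumes "equipotent a b"
  shows "equipotent b a"
proof -
  obtain h where h: "definable_fun_on a h" "bij_betw h (elts a) (elts b)"
    using assms unfolding equipotent_iff by (elim exE conjE)
  show ?thesis
    unfolding equipotent_iff using definable_fun_on_inv_into[OF h] bij_betw_inv_into[OF h(2)]
    by blast
qed

lemma equipotent_trans:
  assumes "equipotent a b" "equipotent b c"
  shows "equipotent a c"
proof -
  obtain h where h: "definable_fun_on a h" "bij_betw h (elts a) (elts b)"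
    using assms(1) unfolding equipotent_iff by (elim exE conjE)
  obtain g where g: "definable_fun_on b g" "bij_betw g (elts b) (elts c)"
    using assms(2) unfolding equipotent_iff by (elim exE conjE)
  have "definable_fun_on a (g \<circ> h)"
    using definable_fun_on_comp[OF h(1) _ g(1)] h(2) by (simp add: bij_betw_def)
  with bij_betw_trans[OF h(2) g(2)] show ?thesis unfolding equipotent_iff by blast
qed

section \<open>Ordinals\<close>

lemma mem_irrefl: "\<not> x \<epsilon> x"
proof -
  obtain p where p: "\<And>z. z \<epsilon> p \<longleftrightarrow> z = x" using pairing[of x x] unfolding is_upair_def by auto
  then have "\<not> is_empty p" unfolding is_empty_def by blast
  from foundation[OF this] show ?thesis unfolding p by blast
qed

lemma ordinal_transitive:
  assumes "is_ordinal k" "x \<epsilon> k" "y \<epsilon> x"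
  shows "y \<epsilon> k"
  using assms unfolding is_ordinal_def is_transitive_def is_subset_def by blast

lemma ordinal_linear:
  assumes "is_ordinal k" "x \<epsilon> k" "y \<epsilon> k"
  shows "x \<epsilon> y \<or> x = y \<or> y \<epsilon> x"
proof -
  have "\<forall>x y. x \<epsilon> k \<and> y \<epsilon> k \<longrightarrow> x \<epsilon> y \<or> x = y \<or> y \<epsilon> x"
    using assms(1) unfolding is_ordinal_def wellordered_by_mem_def by (elim conjE)
  with assms(2,3) show ?thesis by blast
qed

lemma ordinal_mem_trans:
  assumes "is_ordinal k" "z \<epsilon> k" "x \<epsilon> y" "y \<epsilon> z"
  shows "x \<epsilon> z"
proof -
  have "y \<epsilon> k" "x \<epsilon> k" using assms ordinal_transitive[OF assms(1)] by blast+
  then show ?thesis using assms unfolding is_ordinal_def wellordered_by_mem_def by blast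
qed

lemma ordinal_element:
  assumes "is_ordinal k" "x \<epsilon> k"
  shows "is_ordinal x"
proof -
  have "is_transitive x"
    unfolding is_transitive_def is_subset_def using ordinal_mem_trans[OF assms] by blast
  moreover have "is_subset x k"
    unfolding is_subset_def using ordinal_transitive[OF assms] by blast
  then have "wellordered_by_mem x"
    using assms unfolding is_ordinal_def wellordered_by_mem_def is_subset_def by meson
  ultimately show ?thesis unfolding is_ordinal_def by blast
qed

lemma ordinal_least:
  assumes "is_ordinal k" "definable_pred P" "x \<epsilon> k" "P x"
  obtains m where "m \<epsilon> k" "P m" "\<And>y. y \<epsilon> m \<Longrightarrow> \<not> P y"
proof -
  have "definable_pred (\<lambda>x. x \<epsilon> k \<and> P x)"
    by (intro definable_predD[OF assms(2)] definable_intros)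
  note b = mem_sep[OF this]
  have "is_subset (sep k P) k" "\<not> is_empty (sep k P)"
    using assms(3,4) b unfolding is_subset_def is_empty_def by blast+
  then obtain m where m: "m \<epsilon> sep k P" "\<And>y. y \<epsilon> sep k P \<Longrightarrow> m \<preceq> y"
    using assms(1) unfolding is_ordinal_def wellordered_by_mem_def by meson
  show thesis
  proof
    show "m \<epsilon> k" "P m" using m(1) b by blast+
    show "\<not> P y" if y: "y \<epsilon> m" for y
    proof
      assume "P y"
      then have "m \<preceq> y" using m(2) b ordinal_transitive[OF assms(1) \<open>m \<epsilon> k\<close> y] by blast
      then show False using y mem_irrefl ordinal_mem_trans[OF assms(1) \<open>m \<epsilon> k\<close>] by blast
    qed
  qed
qed

lemma ordinal_induct [consumes 2, case_names definable step]:
  assumes "is_ordinal k" "x \<epsilon> k" "definable_pred P"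
    and "\<And>x. x \<epsilon> k \<Longrightarrow> (\<And>y. y \<epsilon> x \<Longrightarrow> P y) \<Longrightarrow> P x"
  shows "P x"
proof (rule ccontr)
  assume "\<not> P x"
  have "definable_pred (\<lambda>x. \<not> P x)"
    by (intro definable_predD[OF assms(3)] definable_intros)
  from assms(1) this assms(2) \<open>\<not> P x\<close> obtain m
    where "m \<epsilon> k" "\<not> P m" "\<And>y. y \<epsilon> m \<Longrightarrow> \<not> \<not> P y"
    by (rule ordinal_least) blast
  with assms(4) show False by blast
qed

lemma transitive_subset_ordinal:
  assumes k: "is_ordinal k" and d: "is_subset d k" "is_transitive d"
  shows "d \<preceq> k"
proof (cases "is_subset k d")
  case True
  then show ?thesis using d(1) extensionality unfolding is_subset_def by blast
next
  case False
  then obtain y where y: "y \<epsilon> k" "\<not> y \<epsilon> d" unfolding is_subset_def by blast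
  have "definable_pred (\<lambda>x. \<not> x \<epsilon> d)"
    by (intro definable_intros)
  from k this y obtain x where x: "x \<epsilon> k" "\<not> x \<epsilon> d" "\<And>y. y \<epsilon> x \<Longrightarrow> y \<epsilon> d"
    by (rule ordinal_least) blast
  have "u \<epsilon> x" if "u \<epsilon> d" for u
    using that x(1,2) ordinal_linear[OF k, of u x] d
    unfolding is_subset_def is_transitive_def by blast
  with x(3) have "d = x" by (intro extensionality) blast
  with x(1) show ?thesis by blast
qed

section \<open>Order types of sets of ordinals\<close>

text \<open>
  Bisimilarity between a subset \<open>A\<close> of an ordinal \<open>k\<close> and \<open>k\<close> itself is the graph of the Mostowski
  collapse of \<open>A\<close>, obtained without recursion.
\<close>

definition bisimulation :: "'a \<Rightarrow> 'a \<Rightarrow> 'a \<Rightarrow> bool" where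
  "bisimulation A k S \<longleftrightarrow> (\<forall>x y. maps_to S x y \<longrightarrow>
     x \<epsilon> A \<and> y \<epsilon> k \<and> rel_set (maps_to S) (elts A \<inter> elts x) (elts y))"

definition bisimilar :: "'a \<Rightarrow> 'a \<Rightarrow> 'a \<Rightarrow> 'a \<Rightarrow> bool" where
  "bisimilar A k x y \<longleftrightarrow> (\<exists>S. bisimulation A k S \<and> maps_to S x y)"

lemma definable_rel_bisimilar: "definable_rel (bisimilar A k)"
  unfolding bisimilar_def bisimulation_def rel_set_def Ball_def Bex_def
    Int_iff mem_Collect_eq
  by (intro definable_intros)

lemmas definable_bisimilar = definable_relD[OF definable_rel_bisimilar]

lemma bisimilarD:
  assumes "bisimilar A k x y"
  shows "x \<epsilon> A" "y \<epsilon> k" "rel_set (bisimilar A k) (elts A \<inter> elts x) (elts y)"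
proof -
  obtain S where S: "bisimulation A k S" "maps_to S x y"
    using assms unfolding bisimilar_def by blast
  then show "x \<epsilon> A" "y \<epsilon> k" unfolding bisimulation_def by blast+
  have "maps_to S \<le> bisimilar A k" using S(1) unfolding bisimilar_def by blast
  from rel_set_mono[OF this] S show "rel_set (bisimilar A k) (elts A \<inter> elts x) (elts y)"
    unfolding bisimulation_def by blast
qed

lemma bisimilar_forth:
  assumes "bisimilar A k x y" "u \<epsilon> A" "u \<epsilon> x"
  obtains v where "v \<epsilon> y" "bisimilar A k u v"
  using rel_setD1[OF bisimilarD(3)[OF assms(1)], of u] assms(2,3) by auto

lemma bisimilar_back:
  assumes "bisimilar A k x y" "v \<epsilon> y"
  obtains u where "u \<epsilon> A" "u \<epsilon> x" "bisimilar A k u v"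
  using rel_setD2[OF bisimilarD(3)[OF assms(1)], of v] assms(2) by auto

lemma bisimilarI:
  assumes "x \<epsilon> A" "y \<epsilon> k" "rel_set (bisimilar A k) (elts A \<inter> elts x) (elts y)"
  shows "bisimilar A k x y"
proof -
  let ?R = "\<lambda>x y. rel_set (bisimilar A k) (elts A \<inter> elts x) (elts y)"
  have "definable_rel ?R"
    unfolding rel_set_def Ball_def Bex_def Int_iff mem_Collect_eq
    by (intro definable_bisimilar definable_intros)
  then obtain S where S: "\<And>x y. maps_to S x y \<longleftrightarrow> x \<epsilon> A \<and> y \<epsilon> k \<and> ?R x y"
    by (rule ex_definable_set_of_pairs[of _ A k]) blast
  have "bisimilar A k \<le> maps_to S" using S bisimilarD by blast
  from rel_set_mono[OF this] have "bisimulation A k S"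
    unfolding bisimulation_def S by blast
  then show ?thesis using S assms unfolding bisimilar_def by blast
qed

lemma bisimilar_functional:
  assumes k: "is_ordinal k" and A: "is_subset A k"
    and y: "bisimilar A k x y" and y': "bisimilar A k x y'"
  shows "y = y'"
proof -
  have not_mem: "\<forall>z z'. bisimilar A k x z \<and> bisimilar A k x z' \<longrightarrow> \<not> z \<epsilon> z'" if "x \<epsilon> k" for x
    using k that
  proof (induction rule: ordinal_induct)
    case definable
    show ?case by (intro definable_bisimilar definable_intros)
  next
    case (step x)
    show ?case
    proof (intro allI impI notI; elim conjE)
      fix z z' assume z: "bisimilar A k x z" "bisimilar A k x z'" "z \<epsilon> z'"
      obtain u where u: "u \<epsilon> A" "u \<epsilon> x" "bisimilar A k u z" using bisimilar_back[OF z(2,3)] .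
      obtain v where "v \<epsilon> z" "bisimilar A k u v" using bisimilar_forth[OF z(1) u(1,2)] .
      with step(2)[OF u(2)] u(3) show False by blast
    qed
  qed
  have "x \<epsilon> k" using bisimilarD(1)[OF y] A unfolding is_subset_def by blast
  from not_mem[OF this] show ?thesis
    using y y' ordinal_linear[OF k bisimilarD(2)[OF y] bisimilarD(2)[OF y']] by blast
qed

lemma bisimilar_injective:
  assumes k: "is_ordinal k" and A: "is_subset A k"
    and x: "bisimilar A k x y" and x': "bisimilar A k x' y"
  shows "x = x'"
proof -
  have not_mem: "\<not> x \<epsilon> x'" if x: "bisimilar A k x y" and x': "bisimilar A k x' y" for x x'
  proof
    assume "x \<epsilon> x'"
    then obtain v where v: "v \<epsilon> y" "bisimilar A k x v"
      using bisimilar_forth[OF x' bisimilarD(1)[OF x]] by blast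
    then show False using bisimilar_functional[OF k A v(2) x] mem_irrefl by blast
  qed
  have "x \<epsilon> k" "x' \<epsilon> k" using bisimilarD(1) x x' A unfolding is_subset_def by blast+
  then show ?thesis using ordinal_linear[OF k] not_mem x x' by blast
qed

lemma bisimilar_not_mem:
  assumes k: "is_ordinal k" and A: "is_subset A k" and "bisimilar A k x y"
  shows "\<not> x \<epsilon> y"
proof -
  have "x \<epsilon> k" using bisimilarD(1) assms(2,3) unfolding is_subset_def by blast
  have "\<forall>y. bisimilar A k x y \<longrightarrow> \<not> x \<epsilon> y"
    using k \<open>x \<epsilon> k\<close>
  proof (induction rule: ordinal_induct)
    case definable
    show ?case by (intro definable_bisimilar definable_intros)
  next
    case (step x)
    then show ?case using bisimilar_back by metis
  qed
  with assms(3) show ?thesis by blast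
qed

text \<open>The collapse maps \<open>x\<close> to the set of its values at the elements of \<open>A\<close> below \<open>x\<close>.\<close>

lemma ex_bisimilar:
  assumes k: "is_ordinal k" and A: "is_subset A k" and "x \<epsilon> A"
  shows "\<exists>y. bisimilar A k x y"
proof -
  have "x \<epsilon> k" using assms(2,3) unfolding is_subset_def by blast
  have "x \<epsilon> A \<longrightarrow> (\<exists>y. bisimilar A k x y)"
    using k \<open>x \<epsilon> k\<close>
  proof (induction rule: ordinal_induct)
    case definable
    show ?case by (intro definable_bisimilar definable_intros)
  next
    case (step x)
    let ?value = "\<lambda>v. \<exists>u. u \<epsilon> A \<and> u \<epsilon> x \<and> bisimilar A k u v"
    let ?d = "sep k ?value"
    have "v \<epsilon> ?d \<longleftrightarrow> v \<epsilon> k \<and> ?value v" for v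
      by (intro mem_sep definable_bisimilar definable_intros)
    then have d: "v \<epsilon> ?d \<longleftrightarrow> ?value v" for v using bisimilarD(2) by blast
    have "is_subset ?d k" unfolding is_subset_def d using bisimilarD(2) by blast
    moreover have "is_transitive ?d"
      unfolding is_transitive_def is_subset_def d
      using bisimilar_back ordinal_mem_trans[OF k step(1)] by metis
    ultimately have "?d \<preceq> k" by (rule transitive_subset_ordinal[OF k])
    moreover have "?d \<noteq> k" using d[of x] step(1) bisimilar_not_mem[OF k A] by metis
    ultimately have "?d \<epsilon> k" by blast
    moreover have "rel_set (bisimilar A k) (elts A \<inter> elts x) (elts ?d)"
      using step(2) unfolding rel_set_def Ball_def Bex_def Int_iff mem_Collect_eq d by blast
    ultimately show ?case using bisimilarI by blast
  qed
  with assms(3) show ?thesis by blast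
qed

lemma subset_ordinal_equipotent_ordinal:
  assumes k: "is_ordinal k" and A: "is_subset A k"
  obtains d where "d \<preceq> k" "equipotent A d"
proof -
  let ?d = "sep k (\<lambda>v. \<exists>u. bisimilar A k u v)"
  have "v \<epsilon> ?d \<longleftrightarrow> v \<epsilon> k \<and> (\<exists>u. bisimilar A k u v)" for v
    by (intro mem_sep definable_bisimilar definable_intros)
  then have d: "v \<epsilon> ?d \<longleftrightarrow> (\<exists>u. bisimilar A k u v)" for v using bisimilarD(2) by blast
  have "equipotent A ?d"
  proof (rule equipotent_definable_rel[OF definable_rel_bisimilar])
    show "\<exists>!y. y \<epsilon> ?d \<and> bisimilar A k x y" if "x \<epsilon> A" for x
      unfolding d using ex_bisimilar[OF k A that] bisimilar_functional[OF k A] by blast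
    show "\<exists>!x. x \<epsilon> A \<and> bisimilar A k x y" if "y \<epsilon> ?d" for y
      using that bisimilarD(1) bisimilar_injective[OF k A] unfolding d by blast
  qed
  moreover have "?d \<preceq> k"
  proof (rule transitive_subset_ordinal[OF k])
    show "is_subset ?d k" unfolding is_subset_def d using bisimilarD(2) by blast
    show "is_transitive ?d"
      unfolding is_transitive_def is_subset_def d by (blast elim: bisimilar_back)
  qed
  ultimately show thesis using that by blast
qed

section \<open>Cofinality\<close>

lemma cardinal_equipotent_subset_unbounded:
  assumes l: "is_cardinal l" and B: "is_subset B l" "equipotent B l" and b: "b \<epsilon> l"
  shows "\<exists>x. x \<epsilon> B \<and> b \<preceq> x"
proof (rule ccontr)
  have l_ord: "is_ordinal l" using l unfolding is_cardinal_def by blast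
  assume "\<not> ?thesis"
  then have "is_subset B b"
    using B(1) b ordinal_linear[OF l_ord] unfolding is_subset_def by blast
  with ordinal_element[OF l_ord b] obtain d where d: "d \<preceq> b" "equipotent B d"
    by (rule subset_ordinal_equipotent_ordinal)
  have "d \<epsilon> l" using d(1) b ordinal_transitive[OF l_ord b] by blast
  moreover have "equipotent d l" using equipotent_trans[OF equipotent_sym[OF d(2)] B(2)] .
  ultimately show False using l unfolding is_cardinal_def by blast
qed

definition cofinal_fun :: "('a \<Rightarrow> 'a) \<Rightarrow> 'a \<Rightarrow> 'a \<Rightarrow> bool" where
  "cofinal_fun h a l \<longleftrightarrow> h ` elts a \<subseteq> elts l \<and> (\<forall>b. b \<epsilon> l \<longrightarrow> (\<exists>x. x \<epsilon> a \<and> b \<preceq> h x))"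

lemma cofinal_fun_comp_bij:
  assumes "cofinal_fun h a l" "bij_betw g (elts d) (elts a)"
  shows "cofinal_fun (h \<circ> g) d l"
  unfolding cofinal_fun_def
proof (intro conjI allI impI)
  have g: "g ` elts d = elts a" using assms(2) unfolding bij_betw_def by simp
  then show "(h \<circ> g) ` elts d \<subseteq> elts l"
    using assms(1) unfolding cofinal_fun_def by (simp only: image_comp[symmetric])
  fix b assume "b \<epsilon> l"
  then obtain x where "x \<epsilon> a" "b \<preceq> h x" using assms(1) unfolding cofinal_fun_def by blast
  moreover from this g obtain v where "v \<epsilon> d" "x = g v" by blast
  ultimately show "\<exists>v. v \<epsilon> d \<and> b \<preceq> (h \<circ> g) v" by auto
qed

lemma ex_cofinal_map_iff:
  "(\<exists>f. is_cofinal_map f a l) \<longleftrightarrow> (\<exists>h. definable_fun_on a h \<and> cofinal_fun h a l)"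
proof -
  let ?cofinal = "\<lambda>m. \<forall>b. b \<epsilon> l \<longrightarrow> (\<exists>x y. x \<epsilon> a \<and> m x y \<and> b \<preceq> y)"
  have cofinal: "cofinal_fun h a l \<longleftrightarrow> h ` elts a \<subseteq> elts l \<and> ?cofinal (graph_on a h)" for h
    unfolding cofinal_fun_def graph_on_def by blast
  show ?thesis
    unfolding is_cofinal_map_def cofinal by (rule ex_function_iff)
qed

lemma cofinal_subset_equipotent_cofinality:
  assumes kl: "is_cofinality k l" and A: "is_subset A k"
    and f: "definable_fun_on A f" "cofinal_fun f A l"
  shows "equipotent A k"
proof -
  have "is_ordinal k" using kl unfolding is_cofinality_def by blast
  then obtain d where d: "d \<preceq> k" "equipotent A d"
    using A by (rule subset_ordinal_equipotent_ordinal)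
  obtain g where g: "definable_fun_on d g" "bij_betw g (elts d) (elts A)"
    using equipotent_sym[OF d(2)] unfolding equipotent_iff by (elim exE conjE)
  have "definable_fun_on d (f \<circ> g)"
    using definable_fun_on_comp[OF g(1) _ f(1)] g(2) by (simp add: bij_betw_def)
  with cofinal_fun_comp_bij[OF f(2) g(2)] have "\<not> d \<epsilon> k"
    using kl unfolding is_cofinality_def ex_cofinal_map_iff by blast
  with d show ?thesis by blast
qed

lemma ex_cofinal_fun_bound:
  assumes k: "is_ordinal k" and f: "definable_fun_on k f" "cofinal_fun f k l"
  obtains h where "definable_fun_on l h" "h ` elts l \<subseteq> elts k" "\<And>a. a \<epsilon> l \<Longrightarrow> a \<preceq> f (h a)"
proof -
  define above where "above a i \<longleftrightarrow> (\<exists>y. graph_on k f i y \<and> a \<preceq> y)" for a i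
  have above_iff: "above a i \<longleftrightarrow> i \<epsilon> k \<and> a \<preceq> f i" for a i
    unfolding above_def graph_on_def by auto
  let ?least = "\<lambda>a i. above a i \<and> (\<forall>j. j \<epsilon> i \<longrightarrow> \<not> above a j)"
  have "definable_rel ?least"
    unfolding above_def by (intro definable_graph_on[OF f(1)] definable_intros)
  moreover have "\<exists>!i. i \<epsilon> k \<and> ?least a i" if a: "a \<epsilon> l" for a
  proof -
    have "definable_pred (above a)"
      unfolding above_def by (intro definable_graph_on[OF f(1)] definable_intros)
    moreover obtain i where "i \<epsilon> k" "above a i"
      using a f(2) unfolding cofinal_fun_def above_iff by blast
    ultimately obtain m where "m \<epsilon> k" "above a m" "\<And>j. j \<epsilon> m \<Longrightarrow> \<not> above a j"
      by (rule ordinal_least[OF k]) blast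
    moreover have "i = j" if "i \<epsilon> k" "j \<epsilon> k" "?least a i" "?least a j" for i j
      using that ordinal_linear[OF k, of i j] by blast
    ultimately show ?thesis by blast
  qed
  ultimately obtain h where h: "definable_fun_on l h" "\<And>a. a \<epsilon> l \<Longrightarrow> h a \<epsilon> k \<and> ?least a (h a)"
    using ex_definable_fun_on[of ?least l k] by blast
  show thesis
  proof (rule that[OF h(1)])
    show "h ` elts l \<subseteq> elts k" using h(2) by blast
    show "a \<preceq> f (h a)" if "a \<epsilon> l" for a using h(2)[OF that] above_iff by blast
  qed
qed

lemma cofinal_fun_if_unbounded_preimage:
  assumes l: "is_ordinal l" and f: "f ` elts A \<subseteq> elts l"
    and h: "definable_fun_on l h" "\<And>a. a \<epsilon> l \<Longrightarrow> a \<preceq> f (h a)"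
    and unbounded: "\<And>b. b \<epsilon> l \<Longrightarrow> \<exists>x. x \<epsilon> preimage h l A \<and> b \<preceq> x"
  shows "cofinal_fun f A l"
  unfolding cofinal_fun_def
proof (intro conjI allI impI)
  show "f ` elts A \<subseteq> elts l" by (rule f)
  fix b assume "b \<epsilon> l"
  from unbounded[OF this] obtain x where "x \<epsilon> preimage h l A" and bx: "b \<preceq> x" by blast
  then have x: "x \<epsilon> l" "h x \<epsilon> A" unfolding mem_preimage[OF h(1)] by blast+
  then have "f (h x) \<epsilon> l" using f by blast
  then have "b \<preceq> f (h x)" using bx h(2)[OF x(1)] ordinal_mem_trans[OF l] by metis
  with x(2) show "\<exists>i. i \<epsilon> A \<and> b \<preceq> f i" by blast
qed

section \<open>Images of ultrafilters\<close>

lemma is_ultrafilter_on_iff: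
  "is_ultrafilter_on F X \<longleftrightarrow>
     (\<forall>A. A \<epsilon> F \<longrightarrow> is_subset A X) \<and>
     X \<epsilon> F \<and>
     (\<forall>A. A \<epsilon> F \<longrightarrow> \<not> is_empty A) \<and>
     (\<forall>A B. A \<epsilon> F \<and> is_subset A B \<and> is_subset B X \<longrightarrow> B \<epsilon> F) \<and>
     (\<forall>A B. A \<epsilon> F \<and> B \<epsilon> F \<longrightarrow> intersection A B \<epsilon> F) \<and>
     (\<forall>A. is_subset A X \<longrightarrow> A \<epsilon> F \<or> difference X A \<epsilon> F)"
proof -
  have "(\<forall>x. x \<epsilon> C \<longleftrightarrow> x \<epsilon> A \<and> x \<epsilon> B) \<longleftrightarrow> C = intersection A B" for A B C
    by (auto simp: mem_intersection intro: extensionality)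
  moreover have "(\<forall>x. x \<epsilon> C \<longleftrightarrow> x \<epsilon> A \<and> \<not> x \<epsilon> B) \<longleftrightarrow> C = difference A B" for A B C
    by (auto simp: mem_difference intro: extensionality)
  ultimately show ?thesis unfolding is_ultrafilter_on_def by simp
qed

lemma ex_image_family:
  assumes "definable_fun_on X h"
  shows "\<exists>G. \<forall>A. A \<epsilon> G \<longleftrightarrow> is_subset A Y \<and> preimage h X A \<epsilon> F"
proof -
  obtain P where P: "\<And>A. A \<epsilon> P \<longleftrightarrow> is_subset A Y" using powerset by blast
  have "(\<forall>x. x \<epsilon> B \<longleftrightarrow> (\<exists>y. graph_on X h x y \<and> y \<epsilon> A)) \<longleftrightarrow> B = preimage h X A" for A B
    by (auto simp: mem_preimage[OF assms] graph_on_def intro: extensionality)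
  then have preimage_mem:
    "preimage h X A \<epsilon> F \<longleftrightarrow> (\<exists>B. B \<epsilon> F \<and> (\<forall>x. x \<epsilon> B \<longleftrightarrow> (\<exists>y. graph_on X h x y \<and> y \<epsilon> A)))" for A
    by simp
  have "definable_pred (\<lambda>A. A \<epsilon> P \<and> preimage h X A \<epsilon> F)"
    unfolding preimage_mem by (intro definable_graph_on[OF assms] definable_intros)
  from mem_sep[OF this] show ?thesis unfolding P by blast
qed

lemma is_ultrafilter_on_image:
  assumes F: "is_ultrafilter_on F X" and h: "definable_fun_on X h" "h ` elts X \<subseteq> elts Y"
    and G: "\<And>A. A \<epsilon> G \<longleftrightarrow> is_subset A Y \<and> preimage h X A \<epsilon> F"
  shows "is_ultrafilter_on G Y"
proof -
  have F_top: "X \<epsilon> F"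
    and F_nonempty: "\<And>A. A \<epsilon> F \<Longrightarrow> \<not> is_empty A"
    and F_up: "\<And>A B. A \<epsilon> F \<Longrightarrow> is_subset A B \<Longrightarrow> is_subset B X \<Longrightarrow> B \<epsilon> F"
    and F_intersection: "\<And>A B. A \<epsilon> F \<Longrightarrow> B \<epsilon> F \<Longrightarrow> intersection A B \<epsilon> F"
    and F_ultra: "\<And>A. is_subset A X \<Longrightarrow> A \<epsilon> F \<or> difference X A \<epsilon> F"
    using F unfolding is_ultrafilter_on_iff by blast+
  show ?thesis
    unfolding is_ultrafilter_on_iff G preimage_codomain[OF h] preimage_intersection[OF h(1)]
      preimage_difference[OF h]
  proof (intro conjI allI impI; (elim conjE)?)
    show "X \<epsilon> F" by (rule F_top)
    show "is_subset Y Y" unfolding is_subset_def by blast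
    show "\<not> is_empty A" if "preimage h X A \<epsilon> F" for A
      using F_nonempty[OF that] unfolding is_empty_def mem_preimage[OF h(1)] by blast
    show "preimage h X B \<epsilon> F" if "preimage h X A \<epsilon> F" "is_subset A B" for A B
      using F_up[OF that(1) preimage_mono[OF h(1) that(2)] preimage_subset[OF h(1)]] .
    show "intersection (preimage h X A) (preimage h X B) \<epsilon> F"
      if "preimage h X A \<epsilon> F" "preimage h X B \<epsilon> F" for A B
      using F_intersection[OF that] .
    show "is_subset (intersection A B) Y" if "is_subset A Y" for A B
      using that unfolding is_subset_def mem_intersection by blast
    show "is_subset A Y \<and> preimage h X A \<epsilon> F \<or>
        is_subset (difference Y A) Y \<and> difference X (preimage h X A) \<epsilon> F" if "is_subset A Y" for A
      using that F_ultra[OF preimage_subset[OF h(1)], of A]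
      unfolding is_subset_def mem_difference by blast
  qed
qed

lemma ex_uniform_ultrafilter_on_cofinality:
  assumes l: "is_cardinal l" and kl: "is_cofinality k l" and F: "is_uniform_ultrafilter_on F l"
  shows "\<exists>G. is_uniform_ultrafilter_on G k"
proof -
  have k: "is_ordinal k" using kl unfolding is_cofinality_def by blast
  have l_ord: "is_ordinal l" using l unfolding is_cardinal_def by blast
  obtain f where f: "definable_fun_on k f" "cofinal_fun f k l"
    using kl unfolding is_cofinality_def ex_cofinal_map_iff by blast
  obtain h where h: "definable_fun_on l h" "h ` elts l \<subseteq> elts k" "\<And>a. a \<epsilon> l \<Longrightarrow> a \<preceq> f (h a)"
    by (rule ex_cofinal_fun_bound[OF k f]) blast
  have F_ultra: "is_ultrafilter_on F l" and F_uniform: "\<And>B. B \<epsilon> F \<Longrightarrow> equipotent B l"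
    using F unfolding is_uniform_ultrafilter_on_def by blast+
  obtain G where G: "\<And>A. A \<epsilon> G \<longleftrightarrow> is_subset A k \<and> preimage h l A \<epsilon> F"
    using ex_image_family[OF h(1)] by blast
  have "is_ultrafilter_on G k" by (rule is_ultrafilter_on_image[OF F_ultra h(1,2) G])
  moreover have "equipotent A k" if "A \<epsilon> G" for A
  proof (rule cofinal_subset_equipotent_cofinality[OF kl])
    show A: "is_subset A k" and "definable_fun_on A f"
      using that definable_fun_on_subset[OF f(1)] unfolding G by blast+
    have "preimage h l A \<epsilon> F" using that unfolding G by blast
    from cardinal_equipotent_subset_unbounded[OF l preimage_subset[OF h(1)] F_uniform[OF this]]
    have "\<exists>x. x \<epsilon> preimage h l A \<and> b \<preceq> x" if "b \<epsilon> l" for b using that .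
    moreover have "f ` elts A \<subseteq> elts l"
      using f(2) A unfolding cofinal_fun_def is_subset_def by blast
    ultimately show "cofinal_fun f A l"
      using cofinal_fun_if_unbounded_preimage[OF l_ord _ h(1,3)] by blast
  qed
  ultimately show ?thesis unfolding is_uniform_ultrafilter_on_def by blast
qed

end

theorem theorem5p1:
  fixes mem :: "'a \<Rightarrow> 'a \<Rightarrow> bool" and lam kap :: 'a
  assumes "ZF_model mem"
    and "set_structure.is_singular_cardinal mem lam"
    and "set_structure.is_cofinality mem kap lam"
    and "\<exists>F. set_structure.is_uniform_ultrafilter_on mem F lam"
  shows "\<exists>F. set_structure.is_uniform_ultrafilter_on mem F kap"
proof -
  interpret ZF_model mem by (fact assms(1))
  have "is_cardinal lam" using assms(2) unfolding is_singular_cardinal_def by blast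
  moreover obtain F where "is_uniform_ultrafilter_on F lam" using assms(4) by blast
  ultimately show ?thesis by (intro ex_uniform_ultrafilter_on_cofinality[OF _ assms(3)])
qed

end
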